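(* Let $\mathcal H$ be a finitely generated, torsion-free, $2$-step nilpotent group with $[\mathcal H,\mathcal H]\simeq\mathbb Z$, and let $S$ be any finite symmetric generating set of $\mathcal H$. Then the horofunction boundary $\partial(\mathcal H,S)$ contains only finitely many $\mathcal H$-orbits of Busemann points. In particular, $\partial(\mathcal H,S)$ contains only countably many Busemann points.
   Context: Let $G$ be a group with finite symmetric generating set $S$, and let $d_S$ be the word metric $d_S(g,h)=\|g^{-1}h\|_S$, where $\|\cdot\|_S$ is word length. For $g\in G$ put $\varphi_g(\ast)=d_S(g,\ast)-d_S(g,e)$, so $\iota: g\mapsto\varphi_g$ maps $G$ into the space of functions $G\to\mathbb R$ with the topology of pointwise convergence. The horofunction boundary (horoboundary) is $\partial(G,S)=\partial(G,d_S)=\overline{\iota(G)}\setminus\iota(G)$; its elements are called horofunctions. A Busemann point is a horofunction of the form $b_\gamma=\lim_{n\to\infty}\varphi_{\gamma(n)}$ for a geodesic ray $\gamma:\mathbb N\to G$ (i.e. $d_S(\gamma(m),\gamma(n))=|m-n|$); in a Cayley graph this agrees with the definition using almost geodesic rays. $G$ acts on $\partial(G,S)$, preserving the set of Busemann points, by $(g\cdot\varphi)(x)=\varphi(g^{-1}x)-\varphi(g^{-1})$. *)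

theory Defs
  imports "HOL-Analysis.Analysis" "HOL-Algebra.Generated_Groups" "HOL-Algebra.Group_Action"
    "HOL-Algebra.Elementary_Groups"
begin

subsection \<open>Nilpotency and torsion\<close>

text \<open>With both arguments equal, this is the library's \<^const>\<open>derived\<close>.\<close>

definition commutator_subgroup :: "('a, 'b) monoid_scheme \<Rightarrow> 'a set \<Rightarrow> 'a set \<Rightarrow> 'a set" where
  "commutator_subgroup G H K =
     generate G (\<Union>h\<in>H. \<Union>k\<in>K. {h \<otimes>\<^bsub>G\<^esub> k \<otimes>\<^bsub>G\<^esub> inv\<^bsub>G\<^esub> h \<otimes>\<^bsub>G\<^esub> inv\<^bsub>G\<^esub> k})"

text \<open>The lower central series, indexed from \<open>0\<close>: term \<open>0\<close> is the whole group and term \<open>1\<close> is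
  the derived subgroup.\<close>

fun lower_central :: "('a, 'b) monoid_scheme \<Rightarrow> nat \<Rightarrow> 'a set" where
  "lower_central G 0 = carrier G"
| "lower_central G (Suc n) = commutator_subgroup G (lower_central G n) (carrier G)"

text \<open>\<open>c\<close> is the exact nilpotency class: a group that is abelian is not \<open>2\<close>-step nilpotent.\<close>

definition step_nilpotent :: "nat \<Rightarrow> ('a, 'b) monoid_scheme \<Rightarrow> bool" where
  "step_nilpotent c G \<longleftrightarrow>
     lower_central G c = {\<one>\<^bsub>G\<^esub>} \<and> (\<forall>k<c. lower_central G k \<noteq> {\<one>\<^bsub>G\<^esub>})"

definition torsion_free :: "('a, 'b) monoid_scheme \<Rightarrow> bool" where
  "torsion_free G \<longleftrightarrow>
     (\<forall>x\<in>carrier G. \<forall>n::nat. n > 0 \<longrightarrow> x [^]\<^bsub>G\<^esub> n = \<one>\<^bsub>G\<^esub> \<longrightarrow> x = \<one>\<^bsub>G\<^esub>)"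


subsection \<open>Word metric\<close>

definition finite_symmetric_generating_set :: "('a, 'b) monoid_scheme \<Rightarrow> 'a set \<Rightarrow> bool" where
  "finite_symmetric_generating_set G S \<longleftrightarrow>
     finite S \<and> S \<subseteq> carrier G \<and> (\<forall>s\<in>S. inv\<^bsub>G\<^esub> s \<in> S) \<and> generate G S = carrier G"

text \<open>Since \<open>S\<close> is symmetric, words in \<open>S\<close> need no formal inverses.\<close>

definition word_length :: "('a, 'b) monoid_scheme \<Rightarrow> 'a set \<Rightarrow> 'a \<Rightarrow> nat" where
  "word_length G S g =
     (LEAST n. \<exists>w. set w \<subseteq> S \<and> length w = n \<and> foldr (\<otimes>\<^bsub>G\<^esub>) w \<one>\<^bsub>G\<^esub> = g)"

definition word_metric :: "('a, 'b) monoid_scheme \<Rightarrow> 'a set \<Rightarrow> 'a \<Rightarrow> 'a \<Rightarrow> real" where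
  "word_metric G S g h = real (word_length G S (inv\<^bsub>G\<^esub> g \<otimes>\<^bsub>G\<^esub> h))"


subsection \<open>Horofunction boundary and Busemann points\<close>

text \<open>Functions on the group are represented as extensional functions on the carrier, i.e. as points
  of the product topology \<^term>\<open>powertop_real (carrier G)\<close>, which is the topology of pointwise
  convergence.\<close>

definition horo_embed :: "('a, 'b) monoid_scheme \<Rightarrow> 'a set \<Rightarrow> 'a \<Rightarrow> 'a \<Rightarrow> real" where
  "horo_embed G S g = (\<lambda>x\<in>carrier G. word_metric G S g x - word_metric G S g \<one>\<^bsub>G\<^esub>)"

definition horoboundary :: "('a, 'b) monoid_scheme \<Rightarrow> 'a set \<Rightarrow> ('a \<Rightarrow> real) set" where
  "horoboundary G S =
     powertop_real (carrier G) closure_of (horo_embed G S ` carrier G) - horo_embed G S ` carrier G"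

definition geodesic_ray :: "('a, 'b) monoid_scheme \<Rightarrow> 'a set \<Rightarrow> (nat \<Rightarrow> 'a) \<Rightarrow> bool" where
  "geodesic_ray G S \<gamma> \<longleftrightarrow>
     range \<gamma> \<subseteq> carrier G \<and> (\<forall>m n. word_metric G S (\<gamma> m) (\<gamma> n) = \<bar>real m - real n\<bar>)"

definition busemann_points :: "('a, 'b) monoid_scheme \<Rightarrow> 'a set \<Rightarrow> ('a \<Rightarrow> real) set" where
  "busemann_points G S =
     {b \<in> horoboundary G S. \<exists>\<gamma>. geodesic_ray G S \<gamma> \<and>
        limitin (powertop_real (carrier G)) (\<lambda>n. horo_embed G S (\<gamma> n)) b sequentially}"

definition horo_action :: "('a, 'b) monoid_scheme \<Rightarrow> 'a \<Rightarrow> ('a \<Rightarrow> real) \<Rightarrow> 'a \<Rightarrow> real" where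
  "horo_action G g \<phi> = (\<lambda>x\<in>carrier G. \<phi> (inv\<^bsub>G\<^esub> g \<otimes>\<^bsub>G\<^esub> x) - \<phi> (inv\<^bsub>G\<^esub> g))"

end

theory Submission
  imports Defs
begin

text \<open>Up to translation, a geodesic ray starts at \<open>\<one>\<close> and reads an infinite word in which every
  letter of some \<open>A \<subseteq> S\<close> occurs infinitely often; the Busemann point depends, up to translation, only
  on \<open>A\<close>, so there are at most \<open>2^card S\<close> orbits. Indeed, permuting the letters of a finite block of
  the word changes its product by a central element. If \<open>a, b\<close> do not commute, then a word
  \<open>a u b x a y b\<close> can be permuted so as to change the product by a positive and by a negative power of
  the generator of the commutator subgroup, and it follows that the changes available arbitrarily far
  out form a group containing all commutators of letters of \<open>A\<close>. Hence, given two rays \<open>s, t\<close> with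
  the same \<open>A\<close>, the letters of a prefix of \<open>s\<close> can be pulled to the front of a long prefix of \<open>t\<close>
  and the resulting commutators compensated further out, so each vertex of \<open>s\<close> lies on a geodesic from
  \<open>\<one>\<close> to a vertex of \<open>t\<close>. This bounds the Busemann function of \<open>t\<close> by that of \<open>s\<close>.\<close>

subsection \<open>Rearranging words in a group with infinite cyclic central commutators\<close>

text \<open>\<open>\<zeta>\<close> embeds the integers in the centre, and \<open>\<omega>\<close> is
  the commutator pairing read off as an exponent. Integer exponents allow the later arguments with
  signs, remainders and finite intervals.\<close>

locale central_commutator_group = group G for G (structure) +
  fixes \<zeta> :: "int \<Rightarrow> 'a" and \<omega> :: "'a \<Rightarrow> 'a \<Rightarrow> int"
  assumes \<zeta>_closed [simp, intro]: "\<zeta> i \<in> carrier G"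
    and \<zeta>_add: "\<zeta> (i + j) = \<zeta> i \<otimes> \<zeta> j"
    and \<zeta>_inj: "inj \<zeta>"
    and \<zeta>_central: "x \<in> carrier G \<Longrightarrow> \<zeta> i \<otimes> x = x \<otimes> \<zeta> i"
    and commute: "x \<in> carrier G \<Longrightarrow> y \<in> carrier G \<Longrightarrow> x \<otimes> y = y \<otimes> x \<otimes> \<zeta> (\<omega> x y)"
begin

abbreviation word_prod :: "'a list \<Rightarrow> 'a" where
  "word_prod w \<equiv> foldr (\<otimes>) w \<one>"

lemma word_prod_closed [simp]: "set w \<subseteq> carrier G \<Longrightarrow> word_prod w \<in> carrier G"
  by (induction w) auto

lemma word_prod_append:
  "set u \<subseteq> carrier G \<Longrightarrow> set v \<subseteq> carrier G \<Longrightarrow> word_prod (u @ v) = word_prod u \<otimes> word_prod v"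
  by (induction u) (auto simp: m_assoc)

declare foldr_append [simp del]

lemma \<zeta>_0 [simp]: "\<zeta> 0 = \<one>"
  using \<zeta>_add[of 0 0] by (simp add: l_cancel_one)

lemma \<zeta>_move:
  assumes "x \<in> carrier G" "y \<in> carrier G"
  shows "x \<otimes> \<zeta> i \<otimes> y = x \<otimes> y \<otimes> \<zeta> i"
  using assms \<zeta>_central[of y i] by (simp add: m_assoc)

lemma \<omega>_unique:
  assumes "x \<in> carrier G" "y \<in> carrier G" "x \<otimes> y = y \<otimes> x \<otimes> \<zeta> d"
  shows "\<omega> x y = d"
proof -
  have "y \<otimes> x \<otimes> \<zeta> (\<omega> x y) = y \<otimes> x \<otimes> \<zeta> d"
    using commute[of x y] assms by simp
  then have "\<zeta> (\<omega> x y) = \<zeta> d"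
    using assms Units_l_cancel[of "y \<otimes> x"] by (simp add: Units_eq)
  then show ?thesis using \<zeta>_inj by (simp add: inj_eq)
qed

text \<open>Carrying \<open>z\<close> leftwards past \<open>y\<close> and then past \<open>x\<close>
  leaves two central factors, whose exponents add up.\<close>

lemma \<omega>_mult_left:
  assumes "x \<in> carrier G" "y \<in> carrier G" "z \<in> carrier G"
  shows "\<omega> (x \<otimes> y) z = \<omega> x z + \<omega> y z"
proof (rule \<omega>_unique)
  have "x \<otimes> y \<otimes> z = x \<otimes> (z \<otimes> y \<otimes> \<zeta> (\<omega> y z))"
    using assms by (simp only: commute[of y z, symmetric] m_assoc)
  also have "\<dots> = (x \<otimes> z) \<otimes> (y \<otimes> \<zeta> (\<omega> y z))"
    using assms by (simp add: m_assoc)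
  also have "\<dots> = (z \<otimes> x \<otimes> \<zeta> (\<omega> x z)) \<otimes> (y \<otimes> \<zeta> (\<omega> y z))"
    using assms by (simp flip: commute[of x z])
  also have "\<dots> = (z \<otimes> x \<otimes> \<zeta> (\<omega> x z) \<otimes> y) \<otimes> \<zeta> (\<omega> y z)"
    using assms by (simp add: m_assoc)
  also have "\<dots> = (z \<otimes> x \<otimes> y \<otimes> \<zeta> (\<omega> x z)) \<otimes> \<zeta> (\<omega> y z)"
    using assms by (simp add: \<zeta>_move[of "z \<otimes> x" y])
  also have "\<dots> = z \<otimes> (x \<otimes> y) \<otimes> \<zeta> (\<omega> x z + \<omega> y z)"
    using assms by (simp add: m_assoc \<zeta>_add)
  finally show "x \<otimes> y \<otimes> z = z \<otimes> (x \<otimes> y) \<otimes> \<zeta> (\<omega> x z + \<omega> y z)" .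
qed (use assms in auto)

lemma \<omega>_anti:
  assumes "x \<in> carrier G" "y \<in> carrier G"
  shows "\<omega> y x = - \<omega> x y"
proof (rule \<omega>_unique)
  have "x \<otimes> y \<otimes> \<zeta> (- \<omega> x y) = y \<otimes> x \<otimes> \<zeta> (\<omega> x y) \<otimes> \<zeta> (- \<omega> x y)"
    using assms by (simp flip: commute[of x y])
  also have "\<dots> = y \<otimes> x"
    using assms by (simp add: m_assoc \<zeta>_add[symmetric])
  finally show "y \<otimes> x = x \<otimes> y \<otimes> \<zeta> (- \<omega> x y)" by simp
qed (use assms in auto)

lemma \<omega>_mult_right:
  assumes "x \<in> carrier G" "y \<in> carrier G" "z \<in> carrier G"
  shows "\<omega> z (x \<otimes> y) = \<omega> z x + \<omega> z y"
  using assms \<omega>_mult_left[of x y z] \<omega>_anti[of "x \<otimes> y" z] \<omega>_anti[of x z] \<omega>_anti[of y z] by simp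

lemma \<omega>_one_left: "x \<in> carrier G \<Longrightarrow> \<omega> \<one> x = 0"
  by (rule \<omega>_unique) auto

text \<open>Equal multisets preserve the length and the set of letters, so replacing a block of a
  word by a rearrangement costs no word length.\<close>

definition rearranges :: "'a list \<Rightarrow> 'a list \<Rightarrow> int \<Rightarrow> bool" where
  "rearranges w w' d \<longleftrightarrow> mset w' = mset w \<and> word_prod w' = word_prod w \<otimes> \<zeta> d"

lemma rearranges_refl: "set w \<subseteq> carrier G \<Longrightarrow> rearranges w w 0"
  by (simp add: rearranges_def)

lemma rearranges_trans:
  assumes "set w \<subseteq> carrier G" "rearranges w w' d" "rearranges w' w'' e"
  shows "rearranges w w'' (d + e)"
  using assms by (simp add: rearranges_def m_assoc \<zeta>_add)

text \<open>The factor \<open>\<zeta> d\<close> is central and can be carried past the second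
  word.\<close>

lemma rearranges_append:
  assumes "set u \<subseteq> carrier G" "set v \<subseteq> carrier G" "rearranges u u' d" "rearranges v v' e"
  shows "rearranges (u @ v) (u' @ v') (d + e)"
proof -
  have "set u' = set u" "set v' = set v"
    using assms unfolding rearranges_def by (auto dest: mset_eq_setD)
  then have "word_prod (u' @ v') = word_prod u \<otimes> \<zeta> d \<otimes> (word_prod v \<otimes> \<zeta> e)"
    using assms by (simp add: word_prod_append rearranges_def)
  also have "\<dots> = word_prod u \<otimes> \<zeta> d \<otimes> word_prod v \<otimes> \<zeta> e"
    using assms by (simp add: m_assoc)
  also have "\<dots> = word_prod u \<otimes> word_prod v \<otimes> \<zeta> d \<otimes> \<zeta> e"
    using assms by (simp add: \<zeta>_move[of "word_prod u" "word_prod v"])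
  also have "\<dots> = word_prod (u @ v) \<otimes> \<zeta> (d + e)"
    using assms by (simp add: word_prod_append m_assoc \<zeta>_add)
  finally show ?thesis using assms by (simp add: rearranges_def)
qed

lemma rearranges_swap:
  assumes "set p \<subseteq> carrier G" "set u \<subseteq> carrier G" "set v \<subseteq> carrier G" "set q \<subseteq> carrier G"
  shows "rearranges (p @ u @ v @ q) (p @ v @ u @ q) (\<omega> (word_prod v) (word_prod u))"
proof -
  have "rearranges (u @ v) (v @ u) (\<omega> (word_prod v) (word_prod u))"
    using assms commute[of "word_prod v" "word_prod u"] by (simp add: rearranges_def word_prod_append)
  then have "rearranges ((u @ v) @ q) ((v @ u) @ q) (\<omega> (word_prod v) (word_prod u) + 0)"
    using assms by (intro rearranges_append[of "u @ v" q] rearranges_refl) auto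
  then have "rearranges (p @ (u @ v) @ q) (p @ (v @ u) @ q) (0 + (\<omega> (word_prod v) (word_prod u) + 0))"
    using assms by (intro rearranges_append[of p "(u @ v) @ q"] rearranges_refl) auto
  then show ?thesis by simp
qed

text \<open>In a factor \<open>a v a\<close> the two \<open>a\<close>s can be moved across \<open>v\<close> in opposite directions.\<close>

lemma rearranges_enclosed:
  assumes "set p \<subseteq> carrier G" "set v \<subseteq> carrier G" "set q \<subseteq> carrier G" "a \<in> carrier G"
  shows "rearranges (p @ a # v @ a # q) (p @ a # a # v @ q) (\<omega> a (word_prod v))"
    and "rearranges (p @ a # v @ a # q) (p @ v @ a # a # q) (- \<omega> a (word_prod v))"
  using rearranges_swap[of "p @ [a]" v "[a]" q] rearranges_swap[of p "[a]" v "a # q"] assms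
    \<omega>_anti[of a "word_prod v"]
  by auto

text \<open>The two \<open>a\<close>s enclose a word and so do the two \<open>b\<close>s. If one of
  these words does not commute with the enclosing letter, \<open>rearranges_enclosed\<close> gives
  both signs. Otherwise the second \<open>a\<close> moves next to the first at no cost; it thereby
  leaves the word between the \<open>b\<close>s, whose commutator with \<open>b\<close> becomes
  nonzero.\<close>

lemma rearranges_both_signs:
  assumes c: "set u \<subseteq> carrier G" "set x \<subseteq> carrier G" "set y \<subseteq> carrier G" "a \<in> carrier G" "b \<in> carrier G"
    and "\<omega> a b \<noteq> 0"
  defines "w \<equiv> a # u @ b # x @ a # y @ [b]"
  obtains d w1 w2 where "d \<noteq> 0" "rearranges w w1 d" "rearranges w w2 (- d)"
proof -
  let ?d1 = "\<omega> a (word_prod (u @ b # x))" and ?d2 = "\<omega> b (word_prod (x @ a # y))"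
  let ?d3 = "\<omega> b (word_prod (x @ y))"
  consider "?d1 \<noteq> 0" | "?d2 \<noteq> 0" | "?d1 = 0" "?d2 = 0" by blast
  then show thesis
  proof cases
    case 1
    then show thesis
      using that rearranges_enclosed[of "[]" "u @ b # x" "y @ [b]" a] c unfolding w_def by auto
  next
    case 2
    then show thesis
      using that rearranges_enclosed[of "a # u" "x @ a # y" "[]" b] c unfolding w_def by auto
  next
    case 3
    have "?d2 = ?d3 + \<omega> b a"
      using c by (simp add: word_prod_append \<omega>_mult_right)
    with 3 assms \<omega>_anti[of a b] have "?d3 \<noteq> 0" by simp
    let ?w = "a # a # u @ b # x @ y @ [b]"
    have wc: "set w \<subseteq> carrier G" using c by (auto simp: w_def)
    have "rearranges w ?w 0"
      using 3 rearranges_enclosed(1)[of "[]" "u @ b # x" "y @ [b]" a] c unfolding w_def by auto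
    moreover obtain w1 w2 where "rearranges ?w w1 ?d3" "rearranges ?w w2 (- ?d3)"
      using rearranges_enclosed[of "a # a # u" "x @ y" "[]" b] c by auto
    ultimately have "rearranges w w1 ?d3" "rearranges w w2 (- ?d3)"
      using rearranges_trans[OF wc] by force+
    with \<open>?d3 \<noteq> 0\<close> that show thesis by blast
  qed
qed

subsection \<open>Rearranging blocks of a recurrent sequence\<close>

definition recurrent :: "'a set \<Rightarrow> (nat \<Rightarrow> 'a) \<Rightarrow> bool" where
  "recurrent A s \<longleftrightarrow> (\<forall>i. s i \<in> A) \<and> (\<forall>a\<in>A. \<forall>n. \<exists>i\<ge>n. s i = a)"

definition shifts :: "(nat \<Rightarrow> 'a) \<Rightarrow> nat \<Rightarrow> int set" where
  "shifts s n = {d. \<exists>m\<ge>n. \<exists>w. rearranges (map s [n..<m]) w d}"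

text \<open>These changes remain available beyond any given block, so they can be combined on
  disjoint blocks; this is why they can be added.\<close>

definition stable_shifts :: "(nat \<Rightarrow> 'a) \<Rightarrow> int set" where
  "stable_shifts s = (\<Inter>n. shifts s n)"

lemma map_upt_append: "n \<le> k \<Longrightarrow> k \<le> m \<Longrightarrow> map s [n..<m] = map s [n..<k] @ map s [k..<m]"
  by (metis le_add_diff_inverse map_append upt_add_eq_append)

lemma map_upt_split: "n \<le> i \<Longrightarrow> i < m \<Longrightarrow> map s [n..<m] = map s [n..<i] @ s i # map s [Suc i..<m]"
  using map_upt_append[of n i m s] by (simp add: upt_conv_Cons)

lemma int_add_closed_mult:
  fixes E :: "int set"
  assumes "0 \<in> E" "\<And>x y. x \<in> E \<Longrightarrow> y \<in> E \<Longrightarrow> x + y \<in> E" "x \<in> E"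
  shows "int k * x \<in> E"
  by (induction k) (auto simp: assms algebra_simps)

text \<open>\<open>- x\<close> is a combination with nonnegative coefficients of \<open>x\<close>
  and of \<open>p\<close> or \<open>q\<close>, whichever has the opposite sign: for instance
  \<open>(- q - 1) * x + x * q\<close> when \<open>x > 0\<close>.\<close>

lemma int_add_closed_uminus:
  fixes E :: "int set"
  assumes zero: "0 \<in> E" and add: "\<And>x y. x \<in> E \<Longrightarrow> y \<in> E \<Longrightarrow> x + y \<in> E"
    and p: "p \<in> E" "p > 0" and q: "q \<in> E" "q < 0" and x: "x \<in> E"
  shows "- x \<in> E"
proof (cases "x > 0")
  case True
  have "int (nat (-q-1)) * x + int (nat x) * q \<in> E"
    by (intro add int_add_closed_mult assms) auto
  also have "int (nat (-q-1)) * x + int (nat x) * q = -x"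
    using True q by (simp add: algebra_simps)
  finally show ?thesis .
next
  case False
  have "int (nat (p-1)) * x + int (nat (-x)) * p \<in> E"
    by (intro add int_add_closed_mult assms) auto
  also have "int (nat (p-1)) * x + int (nat (-x)) * p = -x"
    using False p by (simp add: algebra_simps)
  finally show ?thesis .
qed

context
  fixes s :: "nat \<Rightarrow> 'a" and A :: "'a set"
  assumes rec: "recurrent A s" and A: "A \<subseteq> carrier G" and fin: "finite A"
begin

lemma s_closed: "s i \<in> carrier G"
  using rec A by (auto simp: recurrent_def)

lemma block_closed: "set (map s [n..<m]) \<subseteq> carrier G"
  using s_closed by auto

lemma shifts_prepend:
  assumes "n \<le> m" "rearranges (map s [n..<m]) w d" "e \<in> shifts s m"
  shows "d + e \<in> shifts s n"
proof -
  obtain k v where "m \<le> k" "rearranges (map s [m..<k]) v e"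
    using assms(3) by (auto simp: shifts_def)
  then have "rearranges (map s [n..<k]) (w @ v) (d + e)" "n \<le> k"
    using rearranges_append[OF block_closed block_closed assms(2)] map_upt_append[of n m k s] assms(1)
    by auto
  then show ?thesis by (auto simp: shifts_def)
qed

lemma shifts_antimono: "n \<le> m \<Longrightarrow> shifts s m \<subseteq> shifts s n"
  using shifts_prepend[OF _ rearranges_refl[OF block_closed]] by fastforce

lemma zero_in_shifts: "0 \<in> shifts s n"
  using rearranges_refl[OF block_closed] by (auto simp: shifts_def)

lemma zero_in_stable: "0 \<in> stable_shifts s"
  using zero_in_shifts by (simp add: stable_shifts_def)

text \<open>A block realising \<open>d\<close> ends at some \<open>m\<close>, and \<open>e\<close>
  can still be realised from \<open>m\<close> onwards.\<close>

lemma shifts_add_stable: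
  assumes "d \<in> shifts s n" "e \<in> stable_shifts s"
  shows "d + e \<in> shifts s n"
proof -
  obtain m w where "n \<le> m" "rearranges (map s [n..<m]) w d"
    using assms(1) by (auto simp: shifts_def)
  then show ?thesis using assms(2) by (auto intro: shifts_prepend simp: stable_shifts_def)
qed

lemma stable_add: "d \<in> stable_shifts s \<Longrightarrow> e \<in> stable_shifts s \<Longrightarrow> d + e \<in> stable_shifts s"
  using shifts_add_stable by (simp add: stable_shifts_def)

text \<open>The sets \<open>shifts s n\<close> decrease with \<open>n\<close>. If no element of
  \<open>F\<close> were stable, each would drop out at some index, and beyond the largest of these
  indices nothing of \<open>F\<close> would be left.\<close>

lemma shifts_pigeonhole:
  assumes "finite F" "\<And>n. F \<inter> shifts s n \<noteq> {}"
  shows "F \<inter> stable_shifts s \<noteq> {}"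
proof (rule ccontr)
  assume "\<not> ?thesis"
  then have "\<forall>x\<in>F. \<exists>n. x \<notin> shifts s n" by (auto simp: stable_shifts_def)
  then obtain f where f: "\<And>x. x \<in> F \<Longrightarrow> x \<notin> shifts s (f x)" by metis
  obtain N where "\<And>x. x \<in> F \<Longrightarrow> f x \<le> N"
    using assms(1) by (meson finite_imageI finite_nat_set_iff_bounded_le imageI)
  with f shifts_antimono have "F \<inter> shifts s N = {}" by blast
  with assms(2) show False by blast
qed

lemma next_occurrence: "a \<in> A \<Longrightarrow> \<exists>i\<ge>n. s i = a"
  using rec by (auto simp: recurrent_def)

text \<open>Carrying \<open>s i\<close> to the right end of the block creates its commutator with
  the letters it passes.\<close>

lemma move_letter_in_shifts:
  assumes "n \<le> i" "i < k"
  shows "\<omega> (word_prod (map s [Suc i..<k])) (s i) \<in> shifts s n"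
proof -
  have "rearranges (map s [n..<k]) (map s [n..<i] @ map s [Suc i..<k] @ [s i] @ [])
    (\<omega> (word_prod (map s [Suc i..<k])) (word_prod [s i]))"
    using rearranges_swap[of "map s [n..<i]" "[s i]" "map s [Suc i..<k]" "[]"] block_closed s_closed
      map_upt_split[of n i k s] assms by auto
  moreover have "word_prod [s i] = s i" using s_closed by simp
  ultimately show ?thesis using less_imp_le[OF le_less_trans[OF assms]] by (auto simp: shifts_def)
qed

text \<open>Moving a letter just past the first letter it does not commute with gives a nonzero change
  from a finite set.\<close>

lemma stable_nonzero:
  assumes "a \<in> A" "b \<in> A" "\<omega> b a \<noteq> 0"
  shows "\<exists>e\<in>stable_shifts s. e \<noteq> 0"
proof -
  let ?F = "(\<lambda>c. \<omega> c a) ` A - {0}"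
  have "?F \<inter> shifts s n \<noteq> {}" for n
  proof -
    obtain i where i: "i \<ge> n" "s i = a" using next_occurrence assms by blast
    obtain j where j: "j \<ge> Suc i" "s j = b" using next_occurrence assms by blast
    define k where "k = (LEAST k. Suc i \<le> k \<and> \<omega> (s k) a \<noteq> 0)"
    have k: "Suc i \<le> k" "\<omega> (s k) a \<noteq> 0"
      using LeastI[of "\<lambda>k. Suc i \<le> k \<and> \<omega> (s k) a \<noteq> 0" j] j assms unfolding k_def by auto
    have zero: "\<omega> (s l) a = 0" if "Suc i \<le> l" "l < k" for l
      using not_less_Least[of l "\<lambda>k. Suc i \<le> k \<and> \<omega> (s k) a \<noteq> 0"] that unfolding k_def by auto
    have a: "a \<in> carrier G" using assms A by auto
    \<comment> \<open>By additivity, the letters before the first one that fails to commute with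
      \<open>a\<close> contribute nothing.\<close>
    have "\<omega> (word_prod (map s [Suc i..<l])) a = 0" if "Suc i \<le> l" "l \<le> k" for l
      using that
    proof (induction l rule: dec_induct)
      case base
      then show ?case using a by (simp add: \<omega>_one_left)
    next
      case (step l)
      have "map s [Suc i..<Suc l] = map s [Suc i..<l] @ [s l]" using step by simp
      then show ?case
        using step zero[of l] a block_closed s_closed
        by (simp add: word_prod_append[OF block_closed] \<omega>_mult_left s_closed )
    qed
    from this[of k] k have "\<omega> (word_prod (map s [Suc i..<k])) a = 0" by simp
    moreover have "map s [Suc i..<Suc k] = map s [Suc i..<k] @ [s k]" using k by simp
    ultimately have "\<omega> (word_prod (map s [Suc i..<Suc k])) a = \<omega> (s k) a"
      using a block_closed s_closed
      by (simp add: word_prod_append[OF block_closed] \<omega>_mult_left )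
    with move_letter_in_shifts[of n i "Suc k"] i k have "\<omega> (s k) a \<in> shifts s n" by simp
    moreover have "\<omega> (s k) a \<in> ?F" using k rec by (auto simp: recurrent_def)
    ultimately show ?thesis by blast
  qed
  from shifts_pigeonhole[OF _ this] fin show ?thesis by blast
qed

text \<open>Recurrence yields a block in which \<open>a\<close>, \<open>b\<close>, \<open>a\<close>,
  \<open>b\<close> occur in this order, as \<open>rearranges_both_signs\<close> requires. The size
  of the change may depend on \<open>n\<close>; a uniform bound comes only in
  \<open>stable_both_signs\<close>.\<close>

lemma shifts_both_signs:
  assumes "a \<in> A" "b \<in> A" "\<omega> a b \<noteq> 0"
  shows "\<exists>d\<in>shifts s n. d > 0" "\<exists>d\<in>shifts s n. d < 0"
proof -
  obtain i where i: "i \<ge> n" "s i = a" using next_occurrence assms by blast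
  obtain j where j: "j \<ge> Suc i" "s j = b" using next_occurrence assms by blast
  obtain k where k: "k \<ge> Suc j" "s k = a" using next_occurrence assms by blast
  obtain l where l: "l \<ge> Suc k" "s l = b" using next_occurrence assms by blast
  have c: "a \<in> carrier G" "b \<in> carrier G" using assms A by auto
  have eq: "map s [i..<Suc l] =
      a # map s [Suc i..<j] @ b # map s [Suc j..<k] @ a # map s [Suc k..<l] @ [b]"
    using i j k l map_upt_split[of i i "Suc l" s] map_upt_split[of "Suc i" j "Suc l" s]
      map_upt_split[of "Suc j" k "Suc l" s] map_upt_split[of "Suc k" l "Suc l" s] by simp
  obtain d w1 w2 where "d \<noteq> 0" "rearranges (map s [i..<Suc l]) w1 d"
    "rearranges (map s [i..<Suc l]) w2 (-d)"
    using rearranges_both_signs[OF block_closed block_closed block_closed c assms(3)]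
    unfolding eq by metis
  then have "d \<noteq> 0" "d \<in> shifts s i" "-d \<in> shifts s i"
    using i j k l by (auto simp: shifts_def intro!: exI[of _ "Suc l"])
  with shifts_antimono[OF i(1)] have "d \<noteq> 0" "d \<in> shifts s n" "-d \<in> shifts s n" by auto
  then show "\<exists>d\<in>shifts s n. d > 0" "\<exists>d\<in>shifts s n. d < 0"
    by (metis neg_0_less_iff_less neg_less_0_iff_less not_less_iff_gr_or_eq)+
qed

text \<open>Let \<open>e\<close> be a nonzero stable shift. Adding copies of \<open>e\<close> to a
  shift of the opposite sign brings it near \<open>0\<close> without changing its sign. It then lies
  in a finite interval independent of \<open>n\<close>, and \<open>shifts_pigeonhole\<close>
  applies.\<close>

lemma stable_both_signs:
  assumes "a \<in> A" "b \<in> A" "\<omega> a b \<noteq> 0"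
  shows "\<exists>d\<in>stable_shifts s. d > 0" "\<exists>d\<in>stable_shifts s. d < 0"
proof -
  have mult: "d + int k * e \<in> shifts s n" if "d \<in> shifts s n" "e \<in> stable_shifts s" for d e n k
    using shifts_add_stable that int_add_closed_mult[OF zero_in_stable stable_add] by blast
  have "\<omega> b a \<noteq> 0" using \<omega>_anti[of a b] assms subsetD[OF A] by auto
  then obtain e where e: "e \<in> stable_shifts s" "e \<noteq> 0" using stable_nonzero assms by blast
  have "\<exists>d\<in>stable_shifts s. d > 0" if "e < 0"
  proof -
    have "{1..-e} \<inter> shifts s n \<noteq> {}" for n
    proof -
      obtain p where p: "p \<in> shifts s n" "p > 0" using shifts_both_signs assms by blast
      \<comment> \<open>Dividing \<open>p - 1\<close> instead of \<open>p\<close> puts the result in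
        \<open>{1..-e}\<close>, so that it never becomes \<open>0\<close>.\<close>
      let ?k = "(p - 1) div (-e)"
      have "?k \<ge> 0" using p that by (simp add: div_int_pos_iff)
      then have "p + ?k * e \<in> shifts s n" using mult[OF p(1) e(1), of "nat ?k"] by simp
      moreover have "p + ?k * e = (p - 1) mod (-e) + 1"
        using div_mult_mod_eq[of "p - 1" "-e"] by (simp add: algebra_simps)
      moreover have "(p - 1) mod (-e) \<ge> 0" "(p - 1) mod (-e) < -e" using that by auto
      ultimately have "p + ?k * e \<in> {1..-e} \<inter> shifts s n" by simp
      then show ?thesis by blast
    qed
    from shifts_pigeonhole[OF _ this] show ?thesis by force
  qed
  moreover have "\<exists>d\<in>stable_shifts s. d < 0" if "e > 0"
  proof -
    have "{-e..-1} \<inter> shifts s n \<noteq> {}" for n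
    proof -
      obtain p where p: "p \<in> shifts s n" "p < 0" using shifts_both_signs assms by blast
      let ?k = "(-p - 1) div e"
      have "?k \<ge> 0" using p that by (simp add: div_int_pos_iff)
      then have "p + ?k * e \<in> shifts s n" using mult[OF p(1) e(1), of "nat ?k"] by simp
      moreover have "p + ?k * e = - ((-p - 1) mod e) - 1"
        using div_mult_mod_eq[of "-p - 1" e] by linarith
      moreover have "(-p - 1) mod e \<ge> 0" "(-p - 1) mod e < e" using that by auto
      ultimately have "p + ?k * e \<in> {-e..-1} \<inter> shifts s n" by simp
      then show ?thesis by blast
    qed
    from shifts_pigeonhole[OF _ this] show ?thesis by force
  qed
  ultimately show "\<exists>d\<in>stable_shifts s. d > 0" "\<exists>d\<in>stable_shifts s. d < 0"
    using e by force+
qed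

text \<open>Moving a letter \<open>b\<close> to just before and to just after a later
  \<open>a\<close> gives two shifts that differ by \<open>\<omega> a b\<close>. Far enough out both
  are stable, and stable shifts of both signs make the stable shifts a group.\<close>

lemma stable_contains_commutators:
  assumes "a \<in> A" "b \<in> A"
  shows "\<omega> a b \<in> stable_shifts s"
proof (cases "\<omega> a b = 0")
  case True
  then show ?thesis using zero_in_stable by simp
next
  case False
  obtain p q where p: "p \<in> stable_shifts s" "p > 0" and q: "q \<in> stable_shifts s" "q < 0"
    using stable_both_signs[OF assms False] by blast
  note uminus = int_add_closed_uminus[OF zero_in_stable stable_add p q]
  have mult: "k * p \<in> stable_shifts s" for k
  proof -
    have "int (nat \<bar>k\<bar>) * p \<in> stable_shifts s"
      using int_add_closed_mult[OF zero_in_stable stable_add p(1)] .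
    then show ?thesis using uminus[of "\<bar>k\<bar> * p"] by (cases "k \<ge> 0") auto
  qed
  \<comment> \<open>Otherwise every \<open>shifts s n\<close> contains a non-stable shift, whose
    remainder modulo \<open>p\<close> is again a non-stable element of \<open>shifts s n\<close>.
    The pigeonhole principle would make one of these finitely many remainders stable.\<close>
  have "\<exists>n. shifts s n \<subseteq> stable_shifts s"
  proof (rule ccontr)
    assume neg: "\<nexists>n. shifts s n \<subseteq> stable_shifts s"
    have "({0..<p} - stable_shifts s) \<inter> shifts s n \<noteq> {}" for n
    proof -
      obtain d where d: "d \<in> shifts s n" "d \<notin> stable_shifts s" using neg by blast
      have eq: "d mod p = d + (- (d div p)) * p" using div_mult_mod_eq[of d p] by (simp add: algebra_simps)
      have "d mod p \<in> shifts s n" unfolding eq by (rule shifts_add_stable[OF d(1) mult])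
      moreover have "d mod p \<notin> stable_shifts s"
        using stable_add[OF _ mult, of "d mod p" "d div p"] d by auto
      moreover have "d mod p \<in> {0..<p}" using p by simp
      ultimately show ?thesis by blast
    qed
    from shifts_pigeonhole[OF _ this] show False by blast
  qed
  then obtain n where n: "shifts s n \<subseteq> stable_shifts s" by blast
  obtain i where i: "i \<ge> n" "s i = b" using next_occurrence assms by blast
  obtain k where k: "k \<ge> Suc i" "s k = a" using next_occurrence assms by blast
  have c: "a \<in> carrier G" "b \<in> carrier G" using assms A by auto
  let ?x = "\<omega> (word_prod (map s [Suc i..<k])) b"
  have "map s [Suc i..<Suc k] = map s [Suc i..<k] @ [s k]" using k by simp
  then have "\<omega> (word_prod (map s [Suc i..<Suc k])) b = ?x + \<omega> a b"
    using c k block_closed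
    by (simp add: word_prod_append[OF block_closed] \<omega>_mult_left )
  then have "?x \<in> stable_shifts s" "?x + \<omega> a b \<in> stable_shifts s"
    using move_letter_in_shifts[of n i k] move_letter_in_shifts[of n i "Suc k"] i k n by auto
  with stable_add[OF uminus] show ?thesis by force
qed

lemma stable_contains_word_commutator:
  assumes "set w \<subseteq> A" "a \<in> A"
  shows "\<omega> (word_prod w) a \<in> stable_shifts s"
  using assms(1)
proof (induction w)
  case Nil
  then show ?case using zero_in_stable \<omega>_one_left assms A by auto
next
  case (Cons c w)
  then have "\<omega> (word_prod (c # w)) a = \<omega> c a + \<omega> (word_prod w) a"
    using assms A by (simp add: \<omega>_mult_left subset_iff)
  then show ?case using Cons stable_add stable_contains_commutators assms by simp
qed

end

text \<open>Induction on \<open>n\<close>: the next letter of \<open>s\<close> recurs in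
  \<open>t\<close> and is pulled to the front past the leftover word. A later block of
  \<open>t\<close> absorbs the resulting central factor. Keeping \<open>r\<close> a word over
  \<open>A\<close> makes this factor a stable shift, and \<open>m = n + length r\<close> records
  that no length is lost.\<close>

lemma recurrent_prefix_extends:
  assumes "finite A" "A \<subseteq> carrier G" "recurrent A s" "recurrent A t"
  shows "\<exists>m r. set r \<subseteq> A \<and> m = n + length r \<and>
           word_prod (map t [0..<m]) = word_prod (map s [0..<n]) \<otimes> word_prod r"
proof (induction n)
  case 0
  show ?case by (intro exI[of _ 0] exI[of _ "[]"]) auto
next
  case (Suc n)
  note tc = block_closed[OF assms(4,2,1)] and sc = block_closed[OF assms(3,2,1)]
  have letters: "s i \<in> A" "t i \<in> A" for i using assms by (auto simp: recurrent_def)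
  obtain m r where r: "set r \<subseteq> A" "m = n + length r"
    and mr: "word_prod (map t [0..<m]) = word_prod (map s [0..<n]) \<otimes> word_prod r"
    using Suc by blast
  obtain i where i: "i \<ge> m" "t i = s n"
    using next_occurrence[OF assms(4,2,1), of "s n" m] letters by blast
  define r' where "r' = r @ map t [m..<i]"
  have r'A: "set r' \<subseteq> A" using r letters by (auto simp: r'_def)
  have rc: "set r \<subseteq> carrier G" "set r' \<subseteq> carrier G" "s n \<in> carrier G"
    using r r'A letters assms by auto
  define d where "d = \<omega> (word_prod r') (s n)"
  \<comment> \<open>Stability allows the compensating block to start at \<open>Suc i\<close>, just
    after the letter being pulled forward, so the two changes do not interfere.\<close>
  have "d \<in> shifts t (Suc i)"
    using stable_contains_word_commutator[OF assms(4,2,1) r'A letters(1)]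
    by (auto simp: d_def stable_shifts_def)
  then obtain k v where k: "k \<ge> Suc i" "rearranges (map t [Suc i..<k]) v d"
    by (auto simp: shifts_def)
  have lenv: "length v = k - Suc i" and setv: "set v = set (map t [Suc i..<k])"
    using k(2) mset_eq_length[of v "map t [Suc i..<k]"] mset_eq_setD[of v "map t [Suc i..<k]"]
    by (simp_all add: rearranges_def del: mset_map mset_upt)
  then have vA: "set v \<subseteq> A" "set v \<subseteq> carrier G" using letters assms(2) by auto
  let ?P = "word_prod (map s [0..<n])" and ?Q = "word_prod (map t [Suc i..<k])"
  have cl: "?P \<in> carrier G" "?Q \<in> carrier G" "word_prod r' \<in> carrier G"
    using word_prod_closed[OF sc] word_prod_closed[OF tc] rc by auto
  have "map t [0..<k] = map t [0..<m] @ map t [m..<i] @ [s n] @ map t [Suc i..<k]"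
    using map_upt_append[of 0 m k t] map_upt_split[of m i k t] i k by simp
  then have "word_prod (map t [0..<k]) =
      word_prod (map t [0..<m]) \<otimes> (word_prod (map t [m..<i]) \<otimes> (word_prod [s n] \<otimes> ?Q))"
    using tc rc by (simp add: word_prod_append)
  also have "\<dots> = ?P \<otimes> ((word_prod r \<otimes> word_prod (map t [m..<i])) \<otimes> s n) \<otimes> ?Q"
    using mr word_prod_closed[OF sc] word_prod_closed[OF tc] rc by (simp add: m_assoc)
  also have "word_prod r \<otimes> word_prod (map t [m..<i]) = word_prod r'"
    unfolding r'_def using rc tc by (simp add: word_prod_append)
  also have "word_prod r' \<otimes> s n = s n \<otimes> word_prod r' \<otimes> \<zeta> d"
    unfolding d_def using rc by (intro commute) simp_all
  also have "?P \<otimes> (s n \<otimes> word_prod r' \<otimes> \<zeta> d) \<otimes> ?Q = (?P \<otimes> s n) \<otimes> (word_prod r' \<otimes> (\<zeta> d \<otimes> ?Q))"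
    using rc cl by (simp add: m_assoc)
  \<comment> \<open>The central factor left by the pull turns \<open>?Q\<close> into the rearranged
    block \<open>v\<close>, so the remainder is again a word over \<open>A\<close>.\<close>
  also have "\<zeta> d \<otimes> ?Q = word_prod v"
    using k \<zeta>_central cl by (simp add: rearranges_def)
  also have "word_prod r' \<otimes> word_prod v = word_prod (r' @ v)"
    using rc vA by (simp add: word_prod_append)
  also have "?P \<otimes> s n = word_prod (map s [0..<n] @ [s n])"
    using rc sc by (subst word_prod_append) auto
  finally have "word_prod (map t [0..<k]) = word_prod (map s [0..<Suc n]) \<otimes> word_prod (r' @ v)"
    by simp
  moreover have "k = Suc n + length (r' @ v)"
    using k i r lenv by (simp add: r'_def)
  ultimately show ?case using r'A vA by (intro exI[of _ k] exI[of _ "r' @ v"]) auto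
qed

end

subsection \<open>Busemann points\<close>

locale generated_central_commutator_group = central_commutator_group +
  fixes S :: "'a set"
  assumes generating: "finite_symmetric_generating_set G S"
begin

lemma S_closed: "S \<subseteq> carrier G"
  and S_finite: "finite S"
  and S_inv: "a \<in> S \<Longrightarrow> inv a \<in> S"
  using generating by (auto simp: finite_symmetric_generating_set_def)

lemma word_in_carrier: "set w \<subseteq> S \<Longrightarrow> set w \<subseteq> carrier G"
  using S_closed by blast

section \<open>Words in the generators and word length\<close>

lemma word_exists:
  assumes "x \<in> carrier G"
  shows "\<exists>w. set w \<subseteq> S \<and> word_prod w = x"
proof -
  have "x \<in> generate G S"
    using assms generating by (simp add: finite_symmetric_generating_set_def)
  then show ?thesis
  proof induction
    case one
    show ?case by (intro exI[of _ "[]"]) simp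
  next
    case (incl h)
    then show ?case using S_closed by (intro exI[of _ "[h]"]) auto
  next
    case (inv h)
    then show ?case using S_closed S_inv by (intro exI[of _ "[inv h]"]) auto
  next
    case (eng x y)
    then obtain u v where "set u \<subseteq> S" "set v \<subseteq> S" "word_prod u = x" "word_prod v = y" by blast
    then show ?case
      using word_prod_append word_in_carrier by (intro exI[of _ "u @ v"]) auto
  qed
qed

abbreviation wl :: "'a \<Rightarrow> nat" where
  "wl \<equiv> word_length G S"

lemma wl_le: "set w \<subseteq> S \<Longrightarrow> wl (word_prod w) \<le> length w"
  unfolding word_length_def by (rule Least_le) blast

lemma shortest_word:
  assumes "x \<in> carrier G"
  obtains w where "set w \<subseteq> S" "length w = wl x" "word_prod w = x"
proof -
  have "\<exists>n w. set w \<subseteq> S \<and> length w = n \<and> word_prod w = x"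
    using word_exists[OF assms] by blast
  then have "\<exists>w. set w \<subseteq> S \<and> length w = wl x \<and> word_prod w = x"
    unfolding word_length_def by (rule LeastI_ex)
  with that show thesis by blast
qed

lemma wl_mult:
  assumes "x \<in> carrier G" "y \<in> carrier G"
  shows "wl (x \<otimes> y) \<le> wl x + wl y"
proof -
  obtain u where u: "set u \<subseteq> S" "length u = wl x" "word_prod u = x"
    using shortest_word[OF assms(1)] by blast
  obtain v where v: "set v \<subseteq> S" "length v = wl y" "word_prod v = y"
    using shortest_word[OF assms(2)] by blast
  show ?thesis
    using wl_le[of "u @ v"] u v by (simp add: word_prod_append word_in_carrier)
qed

lemma inv_word_prod:
  "set w \<subseteq> carrier G \<Longrightarrow> inv (word_prod w) = word_prod (rev (map (m_inv G) w))"
proof (induction w)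
  case (Cons a w)
  then have "set (rev (map (m_inv G) w)) \<subseteq> carrier G" by auto
  with Cons show ?case by (simp add: inv_mult_group word_prod_append)
qed simp

lemma wl_inv_word: "set w \<subseteq> S \<Longrightarrow> wl (inv (word_prod w)) \<le> length w"
  using wl_le[of "rev (map (m_inv G) w)"] S_inv
  by (auto simp: inv_word_prod word_in_carrier image_subset_iff)

lemma wl_inv_le: "x \<in> carrier G \<Longrightarrow> wl (inv x) \<le> wl x"
  by (metis shortest_word wl_inv_word)

section \<open>Busemann functions of geodesic letter sequences\<close>

definition geodesic_seq :: "(nat \<Rightarrow> 'a) \<Rightarrow> bool" where
  "geodesic_seq s \<longleftrightarrow> (\<forall>i. s i \<in> S) \<and> (\<forall>n. wl (word_prod (map s [0..<n])) = n)"

text \<open>For a geodesic \<open>s\<close> and \<open>y\<close> in the group, this is the value at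
  \<open>y\<close> of \<open>horo_embed\<close> for the \<open>n\<close>-th vertex, since that
  vertex has distance \<open>n\<close> from \<open>\<one>\<close>.\<close>

definition dist_defect :: "(nat \<Rightarrow> 'a) \<Rightarrow> 'a \<Rightarrow> nat \<Rightarrow> real" where
  "dist_defect s y n = real (wl (inv (word_prod (map s [0..<n])) \<otimes> y)) - real n"

text \<open>The value \<open>0\<close> outside the carrier makes two of these functions equal as soon as they agree on
  the group.\<close>

definition busemann_fun :: "(nat \<Rightarrow> 'a) \<Rightarrow> 'a \<Rightarrow> real" where
  "busemann_fun s y = (if y \<in> carrier G then INF n. dist_defect s y n else 0)"

text \<open>The triangle inequality through the vertex \<open>word_prod u\<close>. It gives both the
  monotonicity along one ray and the comparison of two rays.\<close>

lemma dist_defect_extend: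
  assumes "set u \<subseteq> S" "set r \<subseteq> S" "y \<in> carrier G"
  shows "wl (inv (word_prod u \<otimes> word_prod r) \<otimes> y) \<le> length r + wl (inv (word_prod u) \<otimes> y)"
proof -
  have c: "word_prod u \<in> carrier G" "word_prod r \<in> carrier G"
    using assms word_in_carrier by simp_all
  then have "inv (word_prod u \<otimes> word_prod r) \<otimes> y = inv (word_prod r) \<otimes> (inv (word_prod u) \<otimes> y)"
    using assms by (simp add: inv_mult_group m_assoc)
  then show ?thesis
    using wl_mult[of "inv (word_prod r)" "inv (word_prod u) \<otimes> y"] wl_inv_word[OF assms(2)] c assms
    by simp
qed

text \<open>The defect decreases in \<open>n\<close> and is bounded below by \<open>- wl y\<close>,
  so its limit is its infimum. Two rays can then be compared through infima.\<close>

lemma dist_defect_tendsto: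
  assumes "geodesic_seq s" "y \<in> carrier G"
  shows "dist_defect s y \<longlonglongrightarrow> busemann_fun s y" "bdd_below (range (dist_defect s y))"
proof -
  have s: "set (map s [0..<n]) \<subseteq> S" for n using assms by (auto simp: geodesic_seq_def)
  have c: "word_prod (map s [0..<n]) \<in> carrier G" for n by (rule word_prod_closed[OF word_in_carrier[OF s]])
  show bdd: "bdd_below (range (dist_defect s y))"
  proof (rule bdd_belowI2)
    fix n
    let ?h = "word_prod (map s [0..<n])"
    have "y \<otimes> inv (inv ?h \<otimes> y) = ?h"
      using c assms by (simp add: inv_mult_group m_assoc[symmetric])
    then have "wl ?h \<le> wl y + wl (inv ?h \<otimes> y)"
      using wl_mult[of y "inv (inv ?h \<otimes> y)"] wl_inv_le[of "inv ?h \<otimes> y"] c assms by simp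
    then show "- real (wl y) \<le> dist_defect s y n"
      using assms by (simp add: geodesic_seq_def dist_defect_def)
  qed
  have "decseq (dist_defect s y)"
  proof (rule decseq_SucI)
    fix n
    have "word_prod (map s [0..<Suc n]) = word_prod (map s [0..<n]) \<otimes> word_prod [s n]"
      using s word_in_carrier assms S_closed
      by (subst word_prod_append[symmetric]) (auto simp: geodesic_seq_def)
    then show "dist_defect s y (Suc n) \<le> dist_defect s y n"
      using dist_defect_extend[OF s _ assms(2), of "[s n]" n] assms
      by (simp add: dist_defect_def geodesic_seq_def del: upt_Suc)
  qed
  then show "dist_defect s y \<longlonglongrightarrow> busemann_fun s y"
    using LIMSEQ_decseq_INF[OF bdd] assms by (simp add: busemann_fun_def)
qed

text \<open>Each vertex of \<open>s\<close> extends to a vertex of \<open>t\<close> by a word whose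
  length is the difference of the indices, so the defect does not increase. The hypotheses are
  symmetric in \<open>s\<close> and \<open>t\<close>, hence equality follows by exchanging
  them.\<close>

lemma busemann_fun_le:
  assumes "A \<subseteq> S" "recurrent A s" "recurrent A t" "geodesic_seq s" "geodesic_seq t"
  shows "busemann_fun t y \<le> busemann_fun s y"
proof (cases "y \<in> carrier G")
  case True
  have "(INF n. dist_defect t y n) \<le> (INF n. dist_defect s y n)"
  proof (rule cINF_mono)
    fix n
    have A: "finite A" "A \<subseteq> carrier G" using assms S_finite S_closed finite_subset by auto
    obtain m r where "set r \<subseteq> A" "m = n + length r"
      "word_prod (map t [0..<m]) = word_prod (map s [0..<n]) \<otimes> word_prod r"
      using recurrent_prefix_extends[OF A assms(2,3)] by blast
    moreover from this have "set r \<subseteq> S" using assms by blast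
    moreover have "set (map s [0..<n]) \<subseteq> S" using assms by (auto simp: geodesic_seq_def)
    ultimately have "dist_defect t y m \<le> dist_defect s y n"
      using dist_defect_extend[of "map s [0..<n]" r y] True assms by (simp add: dist_defect_def)
    then show "\<exists>m\<in>UNIV. dist_defect t y m \<le> dist_defect s y n" by blast
  qed (use dist_defect_tendsto(2)[OF assms(5) True] in auto)
  then show ?thesis using True by (simp add: busemann_fun_def)
qed (simp add: busemann_fun_def)

definition busemann_funs :: "('a \<Rightarrow> real) set" where
  "busemann_funs = (\<Union>A\<in>Pow S. busemann_fun ` {s. recurrent A s \<and> geodesic_seq s})"

lemma finite_busemann_funs: "finite busemann_funs"
  unfolding busemann_funs_def
proof (intro finite_UN_I)
  fix A assume "A \<in> Pow S"
  then have eq: "busemann_fun s = busemann_fun t"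
    if "recurrent A s \<and> geodesic_seq s" "recurrent A t \<and> geodesic_seq t" for s t
    using that busemann_fun_le[of A] by (intro ext antisym) auto
  show "finite (busemann_fun ` {s. recurrent A s \<and> geodesic_seq s})" (is "finite (_ ` ?X)")
  proof (cases "?X = {}")
    case False
    then obtain t where "t \<in> ?X" by blast
    then have "busemann_fun ` ?X \<subseteq> {busemann_fun t}"
      using eq[of _ t] by blast
    then show ?thesis by (rule finite_subset) simp
  qed (simp only: image_empty finite.emptyI)
qed (use S_finite in auto)

text \<open>Each of the finitely many letters outside \<open>A\<close> has a last occurrence or
  none, and \<open>N\<close> lies beyond all of these.\<close>

lemma eventually_recurrent:
  fixes t :: "nat \<Rightarrow> 'a"
  assumes "\<And>i. t i \<in> S"
  obtains A N where "A \<subseteq> S" "recurrent A (\<lambda>i. t (N + i))"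
proof -
  define A where "A = {a. \<forall>n. \<exists>i\<ge>n. t i = a}"
  have "\<forall>a\<in>S - A. \<exists>n. \<forall>i\<ge>n. t i \<noteq> a" by (auto simp: A_def)
  then obtain f where f: "\<And>a i. a \<in> S - A \<Longrightarrow> i \<ge> f a \<Longrightarrow> t i \<noteq> a" by metis
  have "finite (f ` (S - A))" using S_finite by simp
  then obtain N where N: "\<And>a. a \<in> S - A \<Longrightarrow> f a \<le> N"
    by (auto simp: finite_nat_set_iff_bounded_le)
  have "t (N + i) \<in> A" for i
    using f[of "t (N + i)" "N + i"] N[of "t (N + i)"] assms by fastforce
  moreover have "\<exists>i\<ge>n. t (N + i) = a" if a: "a \<in> A" for a n
  proof -
    obtain i where "i \<ge> N + n" "t i = a" using a by (auto simp: A_def)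
    then show ?thesis by (intro exI[of _ "i - N"]) auto
  qed
  ultimately have "recurrent A (\<lambda>i. t (N + i))" by (simp add: recurrent_def)
  moreover have "A \<subseteq> S" using assms by (force simp: A_def)
  ultimately show thesis using that by blast
qed

text \<open>Cutting off the part of the ray before its letters become recurrent only translates the
  limit, by the vertex \<open>\<gamma> N\<close> at the cut.\<close>

lemma busemann_point_form:
  assumes "b \<in> busemann_points G S"
  obtains g \<beta> where "g \<in> carrier G" "\<beta> \<in> busemann_funs" "b = horo_action G g \<beta>"
proof -
  obtain \<gamma> where \<gamma>: "geodesic_ray G S \<gamma>"
    and lim: "limitin (powertop_real (carrier G)) (\<lambda>n. horo_embed G S (\<gamma> n)) b sequentially"
    using assms by (auto simp: busemann_points_def)
  have \<gamma>c [simp]: "\<gamma> n \<in> carrier G" for n using \<gamma> by (auto simp: geodesic_ray_def)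
  have dist: "wl (inv (\<gamma> m) \<otimes> \<gamma> (m + n)) = n" for m n
  proof -
    have "real (wl (inv (\<gamma> m) \<otimes> \<gamma> (m + n))) = \<bar>real m - real (m + n)\<bar>"
      using \<gamma> unfolding geodesic_ray_def word_metric_def by blast
    then show ?thesis by simp
  qed
  define t where "t i = inv (\<gamma> i) \<otimes> \<gamma> (Suc i)" for i
  have tS: "t i \<in> S" for i
  proof -
    obtain w where w: "set w \<subseteq> S" "length w = wl (t i)" "word_prod w = t i"
      using shortest_word[of "t i"] by (auto simp: t_def)
    \<comment> \<open>Consecutive vertices of the ray are at distance \<open>1\<close>, so a
      shortest word for \<open>t i\<close> is a single letter.\<close>
    have "length w = 1" using dist[of i 1] w by (simp add: t_def)
    then obtain a where "w = [a]" by (metis One_nat_def length_0_conv length_Suc_conv)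
    with w S_closed show ?thesis by auto
  qed
  obtain A N where A: "A \<subseteq> S" "recurrent A (\<lambda>i. t (N + i))"
    using eventually_recurrent[of t] tS by blast
  define s where "s i = t (N + i)" for i
  let ?h = "\<lambda>n. word_prod (map s [0..<n])"
  have sS: "set (map s [0..<n]) \<subseteq> S" for n using tS by (auto simp: s_def)
  have hc [simp]: "?h n \<in> carrier G" for n by (rule word_prod_closed[OF word_in_carrier[OF sS]])
  have step: "\<gamma> (N + n) = \<gamma> N \<otimes> ?h n" for n
  proof (induction n)
    case (Suc n)
    have sc: "s n \<in> carrier G" using tS S_closed by (auto simp: s_def)
    have "?h (Suc n) = ?h n \<otimes> word_prod [s n]"
      using word_in_carrier[OF sS[of n]] sc by (subst word_prod_append[symmetric]) auto
    moreover have "\<gamma> (N + Suc n) = \<gamma> (N + n) \<otimes> s n"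
      by (simp add: s_def t_def m_assoc[symmetric])
    ultimately show ?case using Suc sc by (simp add: m_assoc)
  qed simp
  have "wl (?h n) = n" for n
    using dist[of N n] by (simp add: step m_assoc[symmetric])
  with tS have geo: "geodesic_seq s" by (simp add: geodesic_seq_def s_def)
  let ?g = "\<gamma> N"
  have "b x = horo_action G ?g (busemann_fun s) x" if x: "x \<in> carrier G" for x
  proof -
    have "(\<lambda>n. horo_embed G S (\<gamma> n) x) \<longlonglongrightarrow> b x"
      using lim x by (auto simp: limitin_componentwise)
    then have "(\<lambda>n. horo_embed G S (\<gamma> (n + N)) x) \<longlonglongrightarrow> b x"
      by (rule LIMSEQ_ignore_initial_segment)
    \<comment> \<open>Left invariance moves \<open>?g\<close> onto the argument, and the two terms
      \<open>real n\<close> cancel.\<close>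
    moreover have "horo_embed G S (\<gamma> (n + N)) x =
        dist_defect s (inv ?g \<otimes> x) n - dist_defect s (inv ?g) n" for n
      using x step[of n]
      by (simp add: horo_embed_def word_metric_def dist_defect_def add.commute[of n] inv_mult_group m_assoc)
    moreover have "(\<lambda>n. dist_defect s (inv ?g \<otimes> x) n - dist_defect s (inv ?g) n)
        \<longlonglongrightarrow> busemann_fun s (inv ?g \<otimes> x) - busemann_fun s (inv ?g)"
      using x by (intro tendsto_diff dist_defect_tendsto geo) auto
    ultimately have "b x = busemann_fun s (inv ?g \<otimes> x) - busemann_fun s (inv ?g)"
      using LIMSEQ_unique by fastforce
    then show ?thesis using x by (simp add: horo_action_def)
  qed
  \<comment> \<open>Limits in the product topology are extensional, so agreement on the carrier
    gives equality of functions.\<close>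
  moreover have "b \<in> extensional (carrier G)"
    using lim by (simp add: limitin_componentwise)
  ultimately have "b = horo_action G ?g (busemann_fun s)"
    by (intro extensionalityI[of _ "carrier G"]) (auto simp: horo_action_def)
  moreover have "busemann_fun s \<in> busemann_funs"
    using A geo unfolding busemann_funs_def s_def[symmetric] by blast
  ultimately show thesis using that \<gamma>c by blast
qed

section \<open>Counting orbits and Busemann points\<close>

lemma horo_action_mult:
  assumes "g \<in> carrier G" "h \<in> carrier G"
  shows "horo_action G g (horo_action G h \<phi>) = horo_action G (g \<otimes> h) \<phi>"
proof
  fix x
  show "horo_action G g (horo_action G h \<phi>) x = horo_action G (g \<otimes> h) \<phi> x"
    using assms by (cases "x \<in> carrier G") (simp_all add: horo_action_def inv_mult_group m_assoc)
qed

text \<open>The right-hand side does not mention \<open>h\<close>, so all translates of one function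
  have the same orbit. The function \<open>\<phi>\<close> itself may lie outside the
  boundary.\<close>

lemma orbit_horo_action:
  assumes "h \<in> carrier G"
  shows "orbit G (horo_action G) (horo_action G h \<phi>) = (\<lambda>g. horo_action G g \<phi>) ` carrier G"
proof (intro equalityI subsetI)
  fix f assume "f \<in> orbit G (horo_action G) (horo_action G h \<phi>)"
  then show "f \<in> (\<lambda>g. horo_action G g \<phi>) ` carrier G"
    using assms by (auto simp: orbit_def horo_action_mult)
next
  fix f assume "f \<in> (\<lambda>g. horo_action G g \<phi>) ` carrier G"
  then obtain g where g: "g \<in> carrier G" "f = horo_action G g \<phi>" by blast
  then have "f = horo_action G (g \<otimes> inv h) (horo_action G h \<phi>)"
    using assms horo_action_mult[of "g \<otimes> inv h" h] by (simp add: m_assoc)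
  then show "f \<in> orbit G (horo_action G) (horo_action G h \<phi>)"
    using assms g by (auto simp: orbit_def)
qed

lemma finite_busemann_orbits: "finite (orbits G (busemann_points G S) (horo_action G))"
proof (rule finite_subset)
  show "orbits G (busemann_points G S) (horo_action G)
      \<subseteq> (\<lambda>\<phi>. (\<lambda>g. horo_action G g \<phi>) ` carrier G) ` busemann_funs"
  proof
    fix X assume "X \<in> orbits G (busemann_points G S) (horo_action G)"
    then obtain b where b: "b \<in> busemann_points G S" "X = orbit G (horo_action G) b"
      by (auto simp: orbits_def)
    obtain g \<beta> where "g \<in> carrier G" "\<beta> \<in> busemann_funs" "b = horo_action G g \<beta>"
      using b(1) by (rule busemann_point_form)
    then show "X \<in> (\<lambda>\<phi>. (\<lambda>g. horo_action G g \<phi>) ` carrier G) ` busemann_funs"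
      using b(2) orbit_horo_action by simp
  qed
qed (simp add: finite_busemann_funs)

lemma countable_carrier: "countable (carrier G)"
proof (rule countable_subset)
  show "carrier G \<subseteq> word_prod ` lists S"
    using word_exists by (force simp: image_iff)
qed (use S_finite in \<open>auto intro: countable_finite\<close>)

lemma countable_busemann_points: "countable (busemann_points G S)"
proof (rule countable_subset)
  show "busemann_points G S \<subseteq> (\<Union>\<phi>\<in>busemann_funs. (\<lambda>g. horo_action G g \<phi>) ` carrier G)"
  proof
    fix b assume "b \<in> busemann_points G S"
    then obtain g \<beta> where "g \<in> carrier G" "\<beta> \<in> busemann_funs" "b = horo_action G g \<beta>"
      by (rule busemann_point_form)
    then show "b \<in> (\<Union>\<phi>\<in>busemann_funs. (\<lambda>g. horo_action G g \<phi>) ` carrier G)" by blast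
  qed
qed (intro countable_UN countable_image countable_carrier countable_finite finite_busemann_funs)

end

section \<open>Exponents of commutators in a group of class two\<close>

lemma central_commutator_group_exists:
  fixes H :: "('a, 'b) monoid_scheme"
  assumes "group H" "step_nilpotent 2 H" "H\<lparr>carrier := derived H (carrier H)\<rparr> \<cong> integer_group"
  shows "\<exists>\<zeta> \<omega>. central_commutator_group H \<zeta> \<omega>"
proof -
  interpret group H by fact
  let ?D = "derived H (carrier H)"
  obtain h where h: "h \<in> iso (H\<lparr>carrier := ?D\<rparr>) integer_group"
    using assms(3) by (auto simp: is_iso_def)
  then have bij: "bij_betw h ?D UNIV" and hom: "\<And>x y. x \<in> ?D \<Longrightarrow> y \<in> ?D \<Longrightarrow> h (x \<otimes>\<^bsub>H\<^esub> y) = h x + h y"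
    by (auto simp: iso_def hom_def integer_group_def)
  have D: "subgroup ?D H" by (simp add: derived_is_subgroup)
  have comm_in_D: "x \<otimes>\<^bsub>H\<^esub> y \<otimes>\<^bsub>H\<^esub> inv\<^bsub>H\<^esub> x \<otimes>\<^bsub>H\<^esub> inv\<^bsub>H\<^esub> y \<in> ?D"
    if "x \<in> carrier H" "y \<in> carrier H" for x y
    using that by (auto simp: derived_def intro!: generate.incl)
  \<comment> \<open>Class \<open>2\<close> then makes all commutators with elements of
    \<open>?D\<close> trivial, that is, \<open>?D\<close> is central.\<close>
  have "lower_central H (Suc 0) = ?D"
    by (simp add: commutator_subgroup_def derived_def)
  then have triv: "commutator_subgroup H ?D (carrier H) = {\<one>\<^bsub>H\<^esub>}"
    using assms(2) by (simp add: step_nilpotent_def numeral_2_eq_2)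
  have central: "z \<otimes>\<^bsub>H\<^esub> x = x \<otimes>\<^bsub>H\<^esub> z" if "z \<in> ?D" "x \<in> carrier H" for z x
  proof -
    have z: "z \<in> carrier H" using that D subgroup.subset by blast
    have "z \<otimes>\<^bsub>H\<^esub> x \<otimes>\<^bsub>H\<^esub> inv\<^bsub>H\<^esub> z \<otimes>\<^bsub>H\<^esub> inv\<^bsub>H\<^esub> x \<in> commutator_subgroup H ?D (carrier H)"
      unfolding commutator_subgroup_def using that by (auto intro!: generate.incl)
    then have "z \<otimes>\<^bsub>H\<^esub> x \<otimes>\<^bsub>H\<^esub> inv\<^bsub>H\<^esub> (x \<otimes>\<^bsub>H\<^esub> z) = \<one>\<^bsub>H\<^esub>"
      using triv z that by (simp add: inv_mult_group m_assoc)
    then show ?thesis using z that by (metis inv_closed inv_equality inv_inv m_closed)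
  qed
  \<comment> \<open>\<open>\<zeta>\<close> inverts the isomorphism \<open>h\<close> from the derived
    subgroup to the integers, and \<open>\<omega>\<close> is the value of \<open>h\<close> at the
    commutator.\<close>
  define \<zeta> where "\<zeta> = inv_into ?D h"
  define \<omega> where "\<omega> x y = h (x \<otimes>\<^bsub>H\<^esub> y \<otimes>\<^bsub>H\<^esub> inv\<^bsub>H\<^esub> x \<otimes>\<^bsub>H\<^esub> inv\<^bsub>H\<^esub> y)" for x y
  have \<zeta>D: "\<zeta> i \<in> ?D" for i
    using bij by (metis \<zeta>_def UNIV_I bij_betw_imp_surj_on inv_into_into)
  have h\<zeta>: "h (\<zeta> i) = i" for i
    using bij by (simp add: \<zeta>_def bij_betw_inv_into_right)
  have \<zeta>h: "\<zeta> (h x) = x" if "x \<in> ?D" for x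
    using bij that by (simp add: \<zeta>_def bij_betw_inv_into_left)
  have "central_commutator_group H \<zeta> \<omega>"
  proof unfold_locales
    show \<zeta>c: "\<zeta> i \<in> carrier H" for i using \<zeta>D D subgroup.subset by blast
    show "\<zeta> (i + j) = \<zeta> i \<otimes>\<^bsub>H\<^esub> \<zeta> j" for i j
      using \<zeta>h[of "\<zeta> i \<otimes>\<^bsub>H\<^esub> \<zeta> j"] \<zeta>D hom h\<zeta> subgroup.m_closed[OF D] by simp
    show "inj \<zeta>" using h\<zeta> by (metis injI)
    show "\<zeta> i \<otimes>\<^bsub>H\<^esub> x = x \<otimes>\<^bsub>H\<^esub> \<zeta> i" if "x \<in> carrier H" for i x using central \<zeta>D that by blast
    show "x \<otimes>\<^bsub>H\<^esub> y = y \<otimes>\<^bsub>H\<^esub> x \<otimes>\<^bsub>H\<^esub> \<zeta> (\<omega> x y)" if xy: "x \<in> carrier H" "y \<in> carrier H" for x y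
    proof -
      let ?c = "x \<otimes>\<^bsub>H\<^esub> y \<otimes>\<^bsub>H\<^esub> inv\<^bsub>H\<^esub> x \<otimes>\<^bsub>H\<^esub> inv\<^bsub>H\<^esub> y"
      \<comment> \<open>Being central, the commutator can be moved to the front, where its inverses
        cancel against \<open>y\<close> and \<open>x\<close>.\<close>
      have "y \<otimes>\<^bsub>H\<^esub> x \<otimes>\<^bsub>H\<^esub> \<zeta> (\<omega> x y) = ?c \<otimes>\<^bsub>H\<^esub> (y \<otimes>\<^bsub>H\<^esub> x)"
        using \<zeta>h[OF comm_in_D[OF xy]] central[OF comm_in_D[OF xy]] xy by (simp add: \<omega>_def)
      also have "\<dots> = x \<otimes>\<^bsub>H\<^esub> y \<otimes>\<^bsub>H\<^esub> inv\<^bsub>H\<^esub> x \<otimes>\<^bsub>H\<^esub> (inv\<^bsub>H\<^esub> y \<otimes>\<^bsub>H\<^esub> y) \<otimes>\<^bsub>H\<^esub> x"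
        using xy by (simp only: m_assoc m_closed inv_closed)
      also have "\<dots> = x \<otimes>\<^bsub>H\<^esub> y \<otimes>\<^bsub>H\<^esub> (inv\<^bsub>H\<^esub> x \<otimes>\<^bsub>H\<^esub> x)"
        using xy by (simp add: m_assoc)
      finally show ?thesis using xy by simp
    qed
  qed
  then show ?thesis by blast
qed

theorem theoremA:
  fixes H :: "('a, 'b) monoid_scheme" and S :: "'a set"
  assumes "group H"
    and "torsion_free H"
    and "step_nilpotent 2 H"
    and "H\<lparr>carrier := derived H (carrier H)\<rparr> \<cong> integer_group"
    and "finite_symmetric_generating_set H S"
  shows "finite (orbits H (busemann_points H S) (horo_action H)) \<and>
         countable (busemann_points H S)"
proof -
  obtain \<zeta> \<omega> where "central_commutator_group H \<zeta> \<omega>"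
    using central_commutator_group_exists assms by blast
  then interpret generated_central_commutator_group H \<zeta> \<omega> S
    using assms by (simp add: generated_central_commutator_group_def
        generated_central_commutator_group_axioms_def)
  show ?thesis using finite_busemann_orbits countable_busemann_points by blast
qed

end
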